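(* For any integer $n\geqslant 0$, $$\sum_{j=0}^{\infty}(-1)^{j(j+1)/2}\,\sigma\,\mathrm{mex}\big(n-j(j+1)/2\big)=\sum_{j=0}^{\infty}D_1\!\left(\frac{n-j(j+1)/2}{2}\right).$$
   Context: For a partition $\lambda$, $\mathrm{mex}(\lambda)$ is the smallest positive integer that is not a part of $\lambda$ (the empty partition has mex $1$). For an integer $m\geqslant 0$, $\sigma\,\mathrm{mex}(m)$ is the sum of $\mathrm{mex}(\lambda)$ over all partitions $\lambda$ of $m$; $\sigma\,\mathrm{mex}(m)=0$ for $m<0$. For a non-negative integer $m$, $D_1(m)$ is the number of partitions of $m$ into distinct parts (so $D_1(0)=1$); $D_1(x)=0$ if $x$ is not a non-negative integer. *)

theory Defs
  imports Complex_Main "HOL-Library.Multiset"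
begin

definition partitions :: "nat \<Rightarrow> nat multiset set" where
  "partitions m = {l. 0 \<notin># l \<and> \<Sum>\<^sub># l = m}"

definition mex :: "nat multiset \<Rightarrow> nat" where
  "mex l = (LEAST k. 0 < k \<and> k \<notin># l)"

definition sigma_mex :: "int \<Rightarrow> int" where
  "sigma_mex m = (if m < 0 then 0 else (\<Sum>l\<in>partitions (nat m). int (mex l)))"

definition D1 :: "rat \<Rightarrow> int" where
  "D1 x = (if x \<in> \<nat>
           then int (card {l \<in> partitions (nat \<lfloor>x\<rfloor>). \<forall>k. count l k \<le> 1})
           else 0)"

text \<open>The following facts show that no default value (a \<^const>\<open>Least\<close> without
  witness, a sum or \<^const>\<open>card\<close> over an infinite set, a divergent series) is involved.\<close>

lemma mex_exists: "\<exists>k. 0 < k \<and> k \<notin># (l :: nat multiset)"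
proof -
  have "finite (insert 0 (set_mset l))" by simp
  then obtain k where "k \<notin> insert 0 (set_mset l)"
    using ex_new_if_finite[OF infinite_UNIV_nat] by blast
  then show ?thesis by auto
qed

lemma size_le_sum_mset: "0 \<notin># l \<Longrightarrow> size l \<le> \<Sum>\<^sub># (l :: nat multiset)"
  by (induction l) auto

lemma elem_le_sum_mset: "k \<in># l \<Longrightarrow> k \<le> \<Sum>\<^sub># (l :: nat multiset)"
  by (metis le_add1 multi_member_split sum_mset.add_mset)

lemma finite_partitions: "finite (partitions m)"
proof (rule finite_subset)
  show "partitions m \<subseteq> mset ` {xs. set xs \<subseteq> {0..m} \<and> length xs \<le> m}"
  proof
    fix l assume "l \<in> partitions m"
    then have l: "0 \<notin># l" "\<Sum>\<^sub># l = m" by (auto simp: partitions_def)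
    obtain xs where xs: "l = mset xs" using ex_mset[of l] by auto
    have "length xs \<le> m" using size_le_sum_mset[OF l(1)] l(2) xs by simp
    moreover have "set xs \<subseteq> {0..m}" using elem_le_sum_mset[of _ l] l(2) xs by auto
    ultimately show "l \<in> mset ` {xs. set xs \<subseteq> {0..m} \<and> length xs \<le> m}"
      using xs by blast
  qed
  show "finite (mset ` {xs. set xs \<subseteq> {0..m} \<and> length xs \<le> m})"
    by (intro finite_imageI finite_lists_length_le) simp
qed

lemma le_triangle: "j \<le> j * (j + 1) div (2 :: nat)"
  by (induction j) auto

lemma sigma_mex_eq_0: "j > n \<Longrightarrow> sigma_mex (int n - int (j * (j + 1) div 2)) = 0"
  using le_triangle[of j] by (simp add: sigma_mex_def del: of_nat_div)

lemma D1_eq_0: "j > n \<Longrightarrow> D1 ((of_nat n - of_nat (j * (j + 1) div 2)) / 2) = 0"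
proof -
  assume "j > n"
  then have "n < j * (j + 1) div 2" using le_triangle[of j] by linarith
  then have "(of_nat n :: rat) < of_nat (j * (j + 1) div 2)" by (simp only: of_nat_less_iff)
  then have "(of_nat n - of_nat (j * (j + 1) div 2)) / 2 < (0 :: rat)"
    by (simp only: divide_less_0_iff) simp
  then show ?thesis unfolding D1_def using Nats_def by (metis Nats_cases not_less of_nat_0_le_iff)
qed

lemma summable_sigma_mex:
  "summable (\<lambda>j. (-1) ^ (j * (j + 1) div 2) * sigma_mex (int n - int (j * (j + 1) div 2)))"
  by (rule summable_finite[of "{..n}"]) (use sigma_mex_eq_0 in \<open>auto simp: not_le\<close>)

lemma summable_D1: "summable (\<lambda>j. D1 ((of_nat n - of_nat (j * (j + 1) div 2)) / 2))"
  by (rule summable_finite[of "{..n}"]) (use D1_eq_0 in \<open>auto simp: not_le\<close>)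

end

theory Submission
  imports Defs "HOL-Computational_Algebra.Formal_Power_Series"
begin

text \<open>
  Write \<open>T\<^sub>k = k (k + 1) / 2\<close>, \<open>\<psi>(q) = \<Sum>\<^sub>k q ^ T\<^sub>k\<close> and let \<open>P(q)\<close> be the generating function
  of the partition numbers \<open>p\<close>. Since \<open>mex l\<close> counts the \<open>k \<ge> 0\<close> such that \<open>1, \<dots>, k\<close> are all
  parts of \<open>l\<close>, removing these parts shows that \<open>\<sigma>mex\<close> has the generating function
  \<open>P(q) \<psi>(q)\<close>, so the left-hand side has the generating function \<open>P(q) \<psi>(-q) \<psi>(q)\<close>.
  Gauss's product for \<open>\<psi>\<close> and Euler's theorem give \<open>P(q) \<psi>(-q) = \<Prod>\<^sub>k (1 + q ^ (2 k))\<close>, the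
  generating function of \<open>D\<^sub>1(m / 2)\<close>, and the right-hand side is this series times \<open>\<psi>(q)\<close>.
  Gauss's product is obtained from the finite identity of Shanks, and all infinite products
  are truncated and treated modulo powers of \<open>q\<close>.
\<close>

subsection \<open>Finite forms of the identities of Gauss and Euler\<close>

text \<open>Since \<open>u\<close> inverts \<open>1 - z\<close>, \<open>u * z\<close> is
  \<open>u - 1\<close>. This one computation drives both the telescoping of the partial sums and the
  final boundary term.\<close>

lemma shanks_step:
  fixes x y z u :: "'a::comm_ring_1"
  assumes "u * (1 - z) = 1"
  shows "(1 - y) * u + ((1 - x * z) * u * y - 1) = u * z * (1 - x * y)"
proof -
  have uz: "u * z = u - 1" using assms by (simp add: algebra_simps)
  have "(1 - y) * u + ((1 - x * z) * u * y - 1) = (u - 1) - u * z * (x * y)"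
    by (simp add: algebra_simps)
  also have "\<dots> = u * z * (1 - x * y)"
    unfolding uz by (simp add: algebra_simps)
  finally show ?thesis .
qed

text \<open>Here \<open>u k\<close> plays the role of \<open>1 / (1 - x ^ (2 k + 1))\<close>, and the partial sums of the
  difference of two consecutive instances of Shanks's identity telescope.\<close>

lemma shanks_telescope:
  fixes x :: "'a::comm_ring_1"
  assumes u: "\<And>k. u k * (1 - x ^ (2 * k + 1)) = 1"
    and R: "\<And>k. R k = (1 - x ^ (2 * k + 2)) * u k"
    and "m \<le> n"
  shows "(\<Sum>s<m. prod R {s..<n} * x ^ (s * (2 * n + 1)) * (R n * x ^ (2 * s) - 1)) =
    prod R {m..<n} * (1 - x ^ (2 * m)) * u n * x ^ (m * (2 * n + 1))"
  using \<open>m \<le> n\<close>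
proof (induction m)
  case (Suc m)
  let ?c = "x ^ (m * (2 * n + 1))"
  let ?y = "x ^ (2 * m)" and ?z = "x ^ (2 * n + 1)"
  have 1: "prod R {m..<n} = R m * prod R {Suc m..<n}"
    using Suc.prems by (simp add: prod.atLeast_Suc_lessThan)
  have 2: "R m * (1 - x ^ (2 * m + 1)) = 1 - x ^ (2 * Suc m)"
    using u[of m] unfolding R by (simp add: mult.assoc)
  have 3: "x ^ (2 * n + 2) = x * ?z" "x ^ (2 * m + 1) = x * ?y" by simp_all
  have 4: "(1 - ?y) * u n + (R n * ?y - 1) = u n * ?z * (1 - x ^ (2 * m + 1))"
    unfolding R 3 using u by (rule shanks_step)
  have "(\<Sum>s<Suc m. prod R {s..<n} * x ^ (s * (2 * n + 1)) * (R n * x ^ (2 * s) - 1)) =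
      prod R {m..<n} * ?c * ((1 - ?y) * u n + (R n * ?y - 1))"
    using Suc by (simp add: algebra_simps)
  also have "\<dots> = prod R {Suc m..<n} * (R m * (1 - x ^ (2 * m + 1))) * u n * (?c * ?z)"
    unfolding 1 4 by (simp only: mult_ac)
  also have "?c * ?z = x ^ (Suc m * (2 * n + 1))"
    by (simp add: power_add[symmetric] algebra_simps)
  finally show ?case unfolding 2 .
qed simp

text \<open>Passing from \<open>n\<close> to \<open>Suc n\<close> multiplies the summand by
  \<open>R n * x ^ (2 * s)\<close>. The resulting change in the sum telescopes, and with the extra
  summand at \<open>s = n\<close> it contributes exactly the two new triangular powers.\<close>

lemma shanks:
  fixes x :: "'a::comm_ring_1"
  assumes u: "\<And>k. u k * (1 - x ^ (2 * k + 1)) = 1"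
    and R: "\<And>k. R k = (1 - x ^ (2 * k + 2)) * u k"
  shows "(\<Sum>s<n. prod R {s..<n} * x ^ (s * (2 * n + 1))) = (\<Sum>s<2 * n. x ^ (s * (s + 1) div 2))"
proof (induction n)
  case (Suc n)
  let ?f = "\<lambda>s. prod R {s..<n} * x ^ (s * (2 * n + 1))"
  let ?z = "x ^ (2 * n + 1)"
  have tri: "2 * n * (2 * n + 1) div 2 = n * (2 * n + 1)"
    "Suc (2 * n) * (Suc (2 * n) + 1) div 2 = (n + 1) * (2 * n + 1)"
    by (simp_all add: algebra_simps)
  have pw: "x ^ (2 * n + 2) = x * ?z" "?z = x * x ^ (2 * n)" by simp_all
  have "(\<Sum>s<Suc n. prod R {s..<Suc n} * x ^ (s * (2 * Suc n + 1))) =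
      (\<Sum>s<Suc n. ?f s * (R n * x ^ (2 * s)))"
    by (intro sum.cong refl) (simp add: power_add[symmetric] algebra_simps)
  also have "\<dots> = (\<Sum>s<Suc n. ?f s) + (\<Sum>s<Suc n. ?f s * (R n * x ^ (2 * s) - 1))"
    by (simp only: sum.distrib[symmetric]) (simp add: algebra_simps)
  also have "(\<Sum>s<Suc n. ?f s * (R n * x ^ (2 * s) - 1)) =
      x ^ (n * (2 * n + 1)) * ((1 - x ^ (2 * n)) * u n + (R n * x ^ (2 * n) - 1))"
    unfolding sum.lessThan_Suc shanks_telescope[OF u R order_refl] by (simp add: algebra_simps)
  \<comment> \<open>Here \<open>y = x ^ (2 * n)\<close>, so \<open>x * y\<close> equals
    \<open>z\<close> and the right side \<open>u * z * (1 - z)\<close> collapses to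
    \<open>z\<close>.\<close>
  also have "(1 - x ^ (2 * n)) * u n + (R n * x ^ (2 * n) - 1) = ?z"
    using shanks_step[OF u[of n], of "x ^ (2 * n)" x] u[of n]
    unfolding R pw(1) pw(2)[symmetric] by (metis mult.commute mult.left_commute mult_1_right)
  also have "x ^ (n * (2 * n + 1)) * ?z = x ^ ((n + 1) * (2 * n + 1))"
    by (simp add: power_add[symmetric] algebra_simps)
  also have "(\<Sum>s<Suc n. ?f s) = (\<Sum>s<2 * n. x ^ (s * (s + 1) div 2)) + x ^ (n * (2 * n + 1))"
    using Suc by simp
  also have "\<dots> + x ^ ((n + 1) * (2 * n + 1)) =
      (\<Sum>s<Suc (Suc (2 * n)). x ^ (s * (s + 1) div 2))"
    unfolding sum.lessThan_Suc tri ..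
  finally show ?case by simp
qed simp

text \<open>In Shanks's identity the summand \<open>s = 0\<close> is the product itself; every other
  summand carries \<open>x ^ (s * (2 * n + 1))\<close> with \<open>s \<ge> 1\<close> and vanishes
  modulo \<open>x ^ (2 * n)\<close>.\<close>

lemma gauss_cong:
  fixes x :: "'a::comm_ring_1"
  assumes u: "\<And>k. u k * (1 - x ^ (2 * k + 1)) = 1" and "n > 0"
  shows "x ^ (2 * n) dvd (\<Sum>s<2 * n. x ^ (s * (s + 1) div 2)) -
    (\<Prod>k<n. (1 - x ^ (2 * k + 2)) * u k)"
proof -
  let ?R = "\<lambda>k. (1 - x ^ (2 * k + 2)) * u k"
  obtain m where n: "n = Suc m" using \<open>n > 0\<close> gr0_implies_Suc by blast
  have "(\<Sum>s<2 * n. x ^ (s * (s + 1) div 2)) =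
      (\<Prod>k<n. ?R k) + (\<Sum>s<m. prod ?R {Suc s..<n} * x ^ (Suc s * (2 * n + 1)))"
    unfolding shanks[of u x ?R, OF u refl, symmetric] n sum.lessThan_Suc_shift by (simp add: atLeast0LessThan)
  moreover have "x ^ (2 * n) dvd (\<Sum>s<m. prod ?R {Suc s..<n} * x ^ (Suc s * (2 * n + 1)))"
    by (intro dvd_sum dvd_mult le_imp_power_dvd) simp
  ultimately show ?thesis by simp
qed

text \<open>Formally, \<open>1 + y ^ (k + 1)\<close> is \<open>1 - y ^ (2 * k + 2)\<close> over
  \<open>1 - y ^ (k + 1)\<close>, so only the factors with exponents \<open>n + 1\<close> to
  \<open>2 * n\<close> survive. Induction avoids the division.\<close>

lemma euler_finite:
  fixes y :: "'a::comm_ring_1"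
  shows "(\<Prod>k<n. (1 + y ^ (k + 1)) * (1 - y ^ (2 * k + 1))) = (\<Prod>k\<in>{n..<2 * n}. 1 - y ^ (k + 1))"
proof (induction n)
  case (Suc n)
  show ?case
  proof (cases "n = 0")
    case False
    let ?Q = "\<Prod>k\<in>{Suc n..<2 * n}. 1 - y ^ (k + 1)"
    have "{n..<2 * n} = insert n {Suc n..<2 * n}" using False by auto
    then have 1: "(\<Prod>k\<in>{n..<2 * n}. 1 - y ^ (k + 1)) = (1 - y ^ (n + 1)) * ?Q" by simp
    have "{Suc n..<2 * Suc n} = insert (2 * n) (insert (2 * n + 1) {Suc n..<2 * n})"
      using False by auto
    then have 2: "(\<Prod>k\<in>{Suc n..<2 * Suc n}. 1 - y ^ (k + 1)) =
        (1 - y ^ (2 * n + 1)) * ((1 - y ^ (2 * n + 2)) * ?Q)" by simp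
    \<comment> \<open>The difference of squares splits \<open>1 - y ^ (2 * n + 2)\<close>, restoring
      the factor \<open>1 - y ^ (n + 1)\<close> lost at the lower end and supplying
      \<open>1 + y ^ (n + 1)\<close>.\<close>
    have 3: "y ^ (2 * n + 2) = y ^ (n + 1) * y ^ (n + 1)"
      by (simp only: power_add[symmetric]) (simp add: mult_2)
    show ?thesis unfolding prod.lessThan_Suc Suc.IH 1 2 3
      by (simp only: ring_distribs mult_1_left mult_1_right mult_ac) simp
  qed (simp add: algebra_simps)
qed simp

lemma dvd_prod_minus_one:
  fixes f :: "'b \<Rightarrow> 'a::comm_ring_1"
  assumes "\<And>k. k \<in> A \<Longrightarrow> d dvd f k - 1"
  shows "d dvd prod f A - 1"
  using assms
proof (induction A rule: infinite_finite_induct)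
  case (insert k A)
  then have "d dvd f k * (prod f A - 1) + (f k - 1)" by (intro dvd_add dvd_mult) auto
  then show ?case using insert by (simp add: algebra_simps)
qed auto

lemma prod_odd_even:
  fixes f :: "nat \<Rightarrow> 'a::comm_monoid_mult"
  shows "(\<Prod>k<n. f (2 * k + 1) * f (2 * k + 2)) = (\<Prod>k\<in>{1..2 * n}. f k)"
proof (induction n)
  case (Suc n)
  have "{1..2 * Suc n} = insert (2 * n + 1) (insert (2 * n + 2) {1..2 * n})" by auto
  then show ?case using Suc by (simp add: mult_ac)
qed simp

subsection \<open>Generating functions of partitions\<close>

text \<open>Prescribing the allowed parts lets generating functions grow by one part size at a time.
  Zero is not excluded here, hence the later hypotheses \<open>0 \<notin> A\<close>.\<close>

definition parts_in :: "nat set \<Rightarrow> nat \<Rightarrow> nat multiset set" where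
  "parts_in A m = {l. set_mset l \<subseteq> A \<and> \<Sum>\<^sub># l = m}"

definition distinct_parts_in :: "nat set \<Rightarrow> nat \<Rightarrow> nat multiset set" where
  "distinct_parts_in A m = {l \<in> parts_in A m. \<forall>k. count l k \<le> 1}"

lemma partitions_eq_parts_in: "m \<le> n \<Longrightarrow> partitions m = parts_in {1..n} m"
  unfolding partitions_def parts_in_def
  using elem_le_sum_mset by (fastforce simp: subset_iff Suc_le_eq intro: gr0I)

lemma finite_parts_in: "0 \<notin> A \<Longrightarrow> finite (parts_in A m)"
  by (rule finite_subset[OF _ finite_partitions[of m]]) (auto simp: parts_in_def partitions_def)

text \<open>If \<open>k\<close> occurs, one copy is removed; further copies may remain, so
  \<open>insert k A\<close> recurs on the right.\<close>

lemma parts_in_insert: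
  assumes "k \<notin> A"
  shows "parts_in (insert k A) m =
    parts_in A m \<union> (if k \<le> m then add_mset k ` parts_in (insert k A) (m - k) else {})"
    (is "?L = ?R")
proof (intro equalityI subsetI)
  fix l assume l: "l \<in> ?L"
  show "l \<in> ?R"
  proof (cases "k \<in># l")
    case True
    then obtain l' where "l = add_mset k l'" by (meson mset_add)
    then show ?thesis using l by (auto simp: parts_in_def)
  next
    case False
    then show ?thesis using l by (auto simp: parts_in_def)
  qed
qed (auto simp: parts_in_def split: if_splits)

text \<open>Here \<open>k\<close> occurs at most once, so after its removal only parts from
  \<open>A\<close> remain.\<close>

lemma distinct_parts_in_insert:
  assumes "k \<notin> A"
  shows "distinct_parts_in (insert k A) m =
    distinct_parts_in A m \<union> (if k \<le> m then add_mset k ` distinct_parts_in A (m - k) else {})"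
    (is "?L = ?R")
proof (intro equalityI subsetI)
  fix l assume l: "l \<in> ?L"
  show "l \<in> ?R"
  proof (cases "k \<in># l")
    case True
    then obtain l' where l': "l = add_mset k l'" by (meson mset_add)
    have c: "count (add_mset k l') i \<le> 1" for i
      using l l' by (simp add: distinct_parts_in_def)
    have "count l' i \<le> 1" for i using c[of i] by (auto split: if_splits)
    moreover have "k \<notin># l'" using c[of k] by (simp add: not_in_iff)
    ultimately have "l' \<in> distinct_parts_in A (m - k)" "k \<le> m"
      using l l' by (auto simp: distinct_parts_in_def parts_in_def)
    then show ?thesis using l' by auto
  next
    case False
    then show ?thesis using l by (auto simp: distinct_parts_in_def parts_in_def)
  qed
next
  fix l assume l: "l \<in> ?R"
  show "l \<in> ?L"
  proof (cases "l \<in> distinct_parts_in A m")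
    case True
    then show ?thesis by (auto simp: distinct_parts_in_def parts_in_def)
  next
    case False
    then obtain l' where l': "l = add_mset k l'" "l' \<in> distinct_parts_in A (m - k)" "k \<le> m"
      using l by (auto split: if_splits)
    then have "count l' k = 0"
      using assms by (auto simp: distinct_parts_in_def parts_in_def count_eq_zero_iff)
    then show ?thesis using l' by (auto simp: distinct_parts_in_def parts_in_def)
  qed
qed

lemma parts_in_empty: "parts_in {} m = (if m = 0 then {{#}} else {})"
  by (auto simp: parts_in_def)

definition parts_fps :: "nat set \<Rightarrow> int fps" where
  "parts_fps A = Abs_fps (\<lambda>m. int (card (parts_in A m)))"

lemma parts_fps_insert:
  assumes "k \<notin> A" "0 \<notin> insert k A"
  shows "parts_fps (insert k A) * (1 - fps_X ^ k) = parts_fps A"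
proof -
  have card: "card (parts_in (insert k A) m) =
      card (parts_in A m) + (if k \<le> m then card (parts_in (insert k A) (m - k)) else 0)" for m
  proof -
    have "parts_in A m \<inter> add_mset k ` parts_in (insert k A) (m - k) = {}"
    proof (rule equals0I)
      fix l assume "l \<in> parts_in A m \<inter> add_mset k ` parts_in (insert k A) (m - k)"
      then have l: "l \<in> parts_in A m" "l \<in> add_mset k ` parts_in (insert k A) (m - k)"
        by auto
      then have "set_mset l \<subseteq> A" by (simp add: parts_in_def)
      moreover have "k \<in># l" using l(2) by (elim imageE) simp
      ultimately show False using \<open>k \<notin> A\<close> by blast
    qed
    then have "card (parts_in A m \<union> add_mset k ` parts_in (insert k A) (m - k)) =
        card (parts_in A m) + card (parts_in (insert k A) (m - k))"
      using assms by (subst card_Un_disjoint) (simp_all add: finite_parts_in card_image inj_on_def)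
    then show ?thesis by (subst parts_in_insert[OF \<open>k \<notin> A\<close>]) simp
  qed
  have "parts_fps (insert k A) = parts_fps A + fps_X ^ k * parts_fps (insert k A)"
  proof (rule fps_ext)
    fix m
    show "fps_nth (parts_fps (insert k A)) m =
        fps_nth (parts_fps A + fps_X ^ k * parts_fps (insert k A)) m"
      using card[of m] by (simp add: parts_fps_def fps_X_power_mult_nth)
  qed
  then show ?thesis by (simp add: algebra_simps)
qed

lemma parts_fps_prod:
  assumes "finite A" "0 \<notin> A"
  shows "parts_fps A * (\<Prod>k\<in>A. 1 - fps_X ^ k) = 1"
  using assms
proof (induction A)
  case empty
  show ?case by (rule fps_ext) (simp add: parts_fps_def parts_in_empty)
next
  case (insert k A)
  then show ?case by (simp add: mult.assoc[symmetric] parts_fps_insert)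
qed

text \<open>Doubling the exponents places the count for \<open>m div 2\<close> at even
  \<open>m\<close> and zero at odd \<open>m\<close>, in agreement with \<open>D1\<close> at
  \<open>m / 2\<close>.\<close>

lemma distinct_parts_fps_prod:
  assumes "finite A" "0 \<notin> A"
  shows "(\<Prod>k\<in>A. 1 + fps_X ^ (2 * k)) =
    (Abs_fps (\<lambda>m. if even m then int (card (distinct_parts_in A (m div 2))) else 0))"
  using assms
proof (induction A)
  case empty
  have "distinct_parts_in {} m = (if m = 0 then {{#}} else {})" for m
    by (auto simp: distinct_parts_in_def parts_in_empty)
  then show ?case by (intro fps_ext) auto
next
  case (insert k A)
  have fin: "finite (distinct_parts_in A m)" for m
    using insert by (simp add: distinct_parts_in_def finite_parts_in)
  have card: "card (distinct_parts_in (insert k A) m) = card (distinct_parts_in A m) +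
      (if k \<le> m then card (distinct_parts_in A (m - k)) else 0)" for m
  proof -
    have "distinct_parts_in A m \<inter> add_mset k ` distinct_parts_in A (m - k) = {}"
    proof (rule equals0I)
      fix l assume "l \<in> distinct_parts_in A m \<inter> add_mset k ` distinct_parts_in A (m - k)"
      then have l: "l \<in> distinct_parts_in A m" "l \<in> add_mset k ` distinct_parts_in A (m - k)"
        by auto
      then have "set_mset l \<subseteq> A" by (simp add: distinct_parts_in_def parts_in_def)
      moreover have "k \<in># l" using l(2) by (elim imageE) simp
      ultimately show False using \<open>k \<notin> A\<close> by blast
    qed
    then have "card (distinct_parts_in A m \<union> add_mset k ` distinct_parts_in A (m - k)) =
        card (distinct_parts_in A m) + card (distinct_parts_in A (m - k))"
      by (subst card_Un_disjoint) (simp_all add: fin card_image inj_on_def)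
    then show ?thesis by (subst distinct_parts_in_insert[OF \<open>k \<notin> A\<close>]) simp
  qed
  let ?F = "\<lambda>B. Abs_fps (\<lambda>m. if even m then int (card (distinct_parts_in B (m div 2))) else 0)"
  have "?F (insert k A) = ?F A + fps_X ^ (2 * k) * ?F A"
  proof (rule fps_ext)
    fix m
    show "fps_nth (?F (insert k A)) m = fps_nth (?F A + fps_X ^ (2 * k) * ?F A) m"
      by (cases "even m") (auto simp: card fps_X_power_mult_nth
          diff_mult_distrib2[symmetric] elim!: evenE)
  qed
  then show ?case using insert by (simp add: algebra_simps)
qed

section \<open>The truncated product for P(q) psi(-q)\<close>

lemma fps_nth_eq_of_dvd_diff:
  fixes f g :: "'a::comm_ring_1 fps"
  assumes "fps_X ^ n dvd f - g" "m < n"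
  shows "fps_nth f m = fps_nth g m"
proof -
  obtain h where "f - g = fps_X ^ n * h" using assms(1) by (elim dvdE)
  then have "fps_nth (f - g) m = 0" using assms(2) by (simp add: fps_X_power_mult_nth)
  then show ?thesis by simp
qed

text \<open>Modulo \<open>fps_X ^ (2 * n)\<close>, Gauss at \<open>- fps_X\<close> turns the sum
  into \<open>E * U\<close>, and Euler at \<open>fps_X ^ 2\<close> gives
  \<open>D * (Od * V) = 1\<close>. Exactly, \<open>U\<close> inverts \<open>V\<close> and the
  partition series inverts \<open>Od * E\<close>; together these leave \<open>D\<close>.\<close>

lemma parts_fps_theta_cong:
  assumes "n > 0"
  shows "fps_X ^ (2 * n) dvd parts_fps {1..2 * n} * (\<Sum>s<2 * n. (- fps_X) ^ (s * (s + 1) div 2)) -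
    (\<Prod>k\<in>{1..n}. 1 + fps_X ^ (2 * k))"
proof -
  let ?X = "fps_X :: int fps"
  let ?P = "parts_fps {1..2 * n}" and ?S = "\<Sum>s<2 * n. (- ?X) ^ (s * (s + 1) div 2)"
  define v where "v k = 1 + ?X ^ (2 * k + 1)" for k
  \<comment> \<open>Over the integers the inverse comes from the constant coefficient of
    \<open>v k\<close>, which is its own inverse 1. As the exponent is odd, \<open>v k\<close> is
    \<open>1 - (- fps_X) ^ (2 * k + 1)\<close>.\<close>
  define u where "u k = fps_left_inverse (v k) 1" for k
  have uv: "u k * v k = 1" for k
    unfolding u_def by (rule fps_left_inverse) (simp add: v_def)
  define E where "E = (\<Prod>k<n. 1 - ?X ^ (2 * k + 2))"
  define Od where "Od = (\<Prod>k<n. 1 - ?X ^ (2 * k + 1))"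
  define D where "D = (\<Prod>k<n. 1 + ?X ^ (2 * k + 2))"
  define U where "U = prod u {..<n}"
  define V where "V = prod v {..<n}"
  have UV: "U * V = 1" by (simp add: U_def V_def prod.distrib[symmetric] uv)
  have D_eq: "(\<Prod>k\<in>{1..n}. 1 + ?X ^ (2 * k)) = D"
    by (simp add: D_def prod.atLeast1_atMost_eq)
  have "u k * (1 - (- ?X) ^ (2 * k + 1)) = 1" for k
    using uv[of k] by (simp add: v_def)
  from gauss_cong[of u, OF this \<open>n > 0\<close>]
  have gauss: "?X ^ (2 * n) dvd ?S - E * U"
    by (simp add: E_def U_def prod.distrib)
  have "?X ^ (2 * n) dvd (\<Prod>k\<in>{n..<2 * n}. 1 - (?X ^ 2) ^ (k + 1)) - 1"
    by (rule dvd_prod_minus_one)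
      (auto simp: power_mult[symmetric] intro!: le_imp_power_dvd simp del: power_Suc)
  also have "(\<Prod>k\<in>{n..<2 * n}. 1 - (?X ^ 2) ^ (k + 1)) = D * (Od * V)"
    unfolding euler_finite[symmetric] D_def Od_def V_def v_def prod.distrib[symmetric]
  proof (intro prod.cong refl)
    fix k
    have "(?X ^ 2) ^ (k + 1) = ?X ^ (2 * k + 2)"
      and "(?X ^ 2) ^ (2 * k + 1) = ?X ^ (2 * k + 1) * ?X ^ (2 * k + 1)"
      by (simp_all add: power_mult[symmetric] power_add[symmetric] algebra_simps)
    moreover have "1 - a * a = (1 - a) * (1 + a)" for a :: "int fps"
      by (simp add: algebra_simps)
    ultimately show "(1 + (?X ^ 2) ^ (k + 1)) * (1 - (?X ^ 2) ^ (2 * k + 1)) =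
        (1 + ?X ^ (2 * k + 2)) * ((1 - ?X ^ (2 * k + 1)) * (1 + ?X ^ (2 * k + 1)))"
      by (simp only:)
  qed
  finally have euler: "?X ^ (2 * n) dvd D * (Od * V) - 1" .
  have P: "?P * (Od * E) = 1"
    using parts_fps_prod[of "{1..2 * n}"] prod_odd_even[of "\<lambda>k. 1 - ?X ^ k" n]
    by (simp add: Od_def E_def prod.distrib)
  \<comment> \<open>In this combination of the two congruences the terms \<open>?P * E * U\<close>
    cancel.\<close>
  have "?X ^ (2 * n) dvd ?P * (?S - E * U) - ?P * E * U * (D * (Od * V) - 1)"
    by (rule dvd_diff[OF dvd_mult[OF gauss] dvd_mult[OF euler]])
  also have "?P * (?S - E * U) - ?P * E * U * (D * (Od * V) - 1) =
      ?P * ?S - (?P * (Od * E)) * (U * V) * D"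
  proof -
    have "p * (s - e * a) - p * e * a * (d * (f * b) - 1) = p * s - (p * (f * e)) * (a * b) * d"
      for p s e a d f b :: "int fps"
      by (simp add: algebra_simps)
    then show ?thesis .
  qed
  also have "\<dots> = ?P * ?S - D" unfolding P UV by simp
  finally show ?thesis unfolding D_eq .
qed

subsection \<open>Sums over triangular numbers\<close>

definition part_count :: "int \<Rightarrow> int" where
  "part_count m = (if m < 0 then 0 else int (card (partitions (nat m))))"

lemma D1_half:
  "D1 (of_nat m / 2) = (if even m then int (card (distinct_parts_in {1..m} (m div 2))) else 0)"
proof (cases "even m")
  case True
  then obtain k where k: "m = 2 * k" by (elim evenE)
  then have "(of_nat m / 2 :: rat) = of_nat k" by simp
  then show ?thesis
    using k partitions_eq_parts_in[of k m] by (simp add: D1_def distinct_parts_in_def)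
next
  case False
  have "(of_nat m / 2 :: rat) \<noteq> of_nat k" for k
  proof
    assume "(of_nat m / 2 :: rat) = of_nat k"
    then have "(of_nat m :: rat) = of_nat (2 * k)" by (simp add: field_simps)
    then have "m = 2 * k" by (simp only: of_nat_eq_iff)
    then show False using False by simp
  qed
  then have "(of_nat m / 2 :: rat) \<notin> \<nat>" by (metis Nats_cases)
  then show ?thesis using False by (simp add: D1_def)
qed

lemma distinct_parts_in_cong:
  "m \<le> n \<Longrightarrow> m \<le> n' \<Longrightarrow> distinct_parts_in {1..n} m = distinct_parts_in {1..n'} m"
  by (simp add: distinct_parts_in_def partitions_eq_parts_in[symmetric] del: One_nat_def)

lemma alternating_part_count_sum:
  fixes m N :: nat
  assumes "m \<le> N"
  shows "(\<Sum>j\<le>N. (-1) ^ (j * (j + 1) div 2) * part_count (int m - int (j * (j + 1) div 2))) =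
    D1 (of_nat m / 2)"
proof -
  \<comment> \<open>This makes \<open>n\<close> positive and \<open>m < 2 * n\<close>, so
    coefficient \<open>m\<close> survives the truncation and the sets of parts \<open>{1..n}\<close>
    and \<open>{1..2 * n}\<close> are large enough.\<close>
  define n where "n = Suc N"
  define T where "T j = j * (j + 1) div 2" for j :: nat
  let ?P = "parts_fps {1..2 * n}"
  have coeff: "fps_nth (?P * (- fps_X) ^ T j) m = (-1) ^ T j * part_count (int m - int (T j))" for j
  proof -
    have sgn: "(- fps_X) ^ T j = fps_const ((-1 :: int) ^ T j) * fps_X ^ T j"
      by (subst power_minus) (simp add: fps_const_power[symmetric] fps_const_neg[symmetric]
          del: fps_const_power fps_const_neg)
    have "?P * (- fps_X) ^ T j = fps_const ((-1) ^ T j) * (fps_X ^ T j * ?P)"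
      unfolding sgn by (simp only: mult_ac)
    then have "fps_nth (?P * (- fps_X) ^ T j) m = (-1) ^ T j * fps_nth (fps_X ^ T j * ?P) m"
      by (simp only: fps_mult_left_const_nth)
    also have "fps_nth (fps_X ^ T j * ?P) m = part_count (int m - int (T j))"
      using assms
      by (auto simp: fps_X_power_mult_nth parts_fps_def part_count_def n_def nat_diff_distrib
          partitions_eq_parts_in[of "m - T j" "2 * n"])
    finally show ?thesis .
  qed
  have "(\<Sum>j\<le>N. (-1) ^ T j * part_count (int m - int (T j))) =
      (\<Sum>j<2 * n. (-1) ^ T j * part_count (int m - int (T j)))"
  proof (rule sum.mono_neutral_left)
    show "\<forall>j\<in>{..<2 * n} - {..N}. (-1) ^ T j * part_count (int m - int (T j)) = 0"
    proof
      fix j assume "j \<in> {..<2 * n} - {..N}"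
      then have "m < T j" using le_triangle[of j] assms by (simp add: T_def)
      then show "(-1) ^ T j * part_count (int m - int (T j)) = 0" by (simp add: part_count_def)
    qed
  qed (auto simp: n_def)
  also have "\<dots> = fps_nth (?P * (\<Sum>j<2 * n. (- fps_X) ^ T j)) m"
    by (simp add: sum_distrib_left fps_sum_nth coeff del: One_nat_def)
  also have "\<dots> = fps_nth (\<Prod>k\<in>{1..n}. 1 + fps_X ^ (2 * k)) m"
    unfolding T_def
    by (rule fps_nth_eq_of_dvd_diff[OF parts_fps_theta_cong]) (use assms in \<open>auto simp: n_def\<close>)
  also have "\<dots> = D1 (of_nat m / 2)"
    using distinct_parts_in_cong[of "m div 2" n m] assms
    by (subst distinct_parts_fps_prod) (auto simp: D1_half n_def)
  finally show ?thesis unfolding T_def .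
qed

section \<open>The sum of mex in terms of partition numbers\<close>

lemma less_mex_iff: "k < mex l \<longleftrightarrow> {1..k} \<subseteq> set_mset l"
proof
  assume "k < mex l"
  show "{1..k} \<subseteq> set_mset l"
  proof
    fix i assume "i \<in> {1..k}"
    then have "i < mex l" "0 < i" using \<open>k < mex l\<close> by auto
    then show "i \<in># l" unfolding mex_def using not_less_Least by blast
  qed
next
  assume "{1..k} \<subseteq> set_mset l"
  moreover have "0 < mex l \<and> mex l \<notin># l" unfolding mex_def by (rule LeastI_ex[OF mex_exists])
  ultimately have "mex l \<notin> {1..k}" "0 < mex l" by blast+
  then show "k < mex l" by simp
qed

text \<open>Removing one copy of each of \<open>1, ..., k\<close> is a bijection that lowers the sum
  by a triangular number. If that number exceeds \<open>m\<close>, there are no such partitions,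
  which is the zero case of \<open>part_count\<close>.\<close>

lemma card_partitions_containing:
  "int (card {l \<in> partitions m. {1..k} \<subseteq> set_mset l}) =
    part_count (int m - int (k * (k + 1) div 2))"
proof -
  let ?s = "mset_set {1..k}" and ?A = "{l \<in> partitions m. {1..k} \<subseteq> set_mset l}"
  have sum: "\<Sum>\<^sub># ?s = k * (k + 1) div 2"
    using gauss_sum_from_Suc_0[of k, where ?'a = nat] sum_unfold_sum_mset[of "\<lambda>i. i" "{1..k}"]
    by simp
  have sub: "?s \<subseteq># l" if "{1..k} \<subseteq> set_mset l" for l
    using subset_imp_msubset_mset_set[OF that] mset_set_set_mset_msubset[of l]
    by (metis finite_set_mset subset_mset.order_trans)
  show ?thesis
  proof (cases "k * (k + 1) div 2 \<le> m")
    case True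
    have "bij_betw (\<lambda>l. l + ?s) (partitions (m - k * (k + 1) div 2)) ?A"
    proof (rule bij_betw_byWitness[of _ "\<lambda>l. l - ?s"])
      show "\<forall>l\<in>?A. l - ?s + ?s = l" using sub by auto
      show "(\<lambda>l. l + ?s) ` partitions (m - k * (k + 1) div 2) \<subseteq> ?A"
        using True sum by (auto simp: partitions_def)
      show "(\<lambda>l. l - ?s) ` ?A \<subseteq> partitions (m - k * (k + 1) div 2)"
      proof clarify
        fix l assume l: "l \<in> partitions m" "{1..k} \<subseteq> set_mset l"
        have "\<Sum>\<^sub># l = \<Sum>\<^sub># (l - ?s) + \<Sum>\<^sub># ?s"
          using sub[OF l(2)] by (metis subset_mset.diff_add sum_mset.union)
        then show "l - ?s \<in> partitions (m - k * (k + 1) div 2)"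
          using l sum by (auto simp: partitions_def dest: in_diffD)
      qed
    qed simp
    then show ?thesis
      using True by (simp add: part_count_def nat_diff_distrib bij_betw_same_card[symmetric])
  next
    case False
    have "?A = {}"
    proof (rule ccontr)
      assume "?A \<noteq> {}"
      then obtain l where "\<Sum>\<^sub># l = m" "?s \<subseteq># l" using sub by (auto simp: partitions_def)
      then have "k * (k + 1) div 2 \<le> m"
        using sum by (metis le_add2 subset_mset.diff_add sum_mset.union)
      with False show False by simp
    qed
    then have "card ?A = 0" by (simp only: card.empty)
    then show ?thesis using False by (simp add: part_count_def)
  qed
qed

lemma sigma_mex_eq_sum:
  assumes "i \<le> int N"
  shows "sigma_mex i = (\<Sum>k\<le>N. part_count (i - int (k * (k + 1) div 2)))"
proof (cases "i < 0")
  case True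
  then show ?thesis by (simp add: sigma_mex_def part_count_def)
next
  case False
  then obtain m where i: "i = int m" by (metis nonneg_int_cases not_less)
  then have m: "m \<le> N" using assms by simp
  have "int (mex l) = (\<Sum>k\<le>N. if {1..k} \<subseteq> set_mset l then 1 else 0)"
    if "l \<in> partitions m" for l
  proof -
    \<comment> \<open>A positive \<open>k\<close> below the mex is itself a part, so it is at most
      \<open>m\<close>; cutting the count at \<open>N\<close> loses nothing.\<close>
    have "k \<le> N" if "k < mex l" for k
    proof (cases "k = 0")
      case False
      then have "k \<in># l" using that by (auto simp: less_mex_iff)
      then show ?thesis
        using elem_le_sum_mset[of k l] \<open>l \<in> partitions m\<close> m by (simp add: partitions_def)
    qed simp
    then have "{k \<in> {..N}. {1..k} \<subseteq> set_mset l} = {..<mex l}"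
      unfolding less_mex_iff[symmetric] by auto
    then show ?thesis by (simp add: sum.If_cases Int_def del: One_nat_def)
  qed
  then have "sigma_mex i =
      (\<Sum>l\<in>partitions m. \<Sum>k\<le>N. if {1..k} \<subseteq> set_mset l then 1 else 0)"
    by (simp add: sigma_mex_def i)
  also have "\<dots> = (\<Sum>k\<le>N. \<Sum>l\<in>partitions m. if {1..k} \<subseteq> set_mset l then 1 else 0)"
    by (rule sum.swap)
  also have "\<dots> = (\<Sum>k\<le>N. int (card {l \<in> partitions m. {1..k} \<subseteq> set_mset l}))"
    by (simp add: sum.If_cases finite_partitions Int_def)
  finally show ?thesis unfolding card_partitions_containing i .
qed

theorem theorem5:
  fixes n :: nat
  shows "(\<Sum>j::nat. (-1) ^ (j * (j + 1) div 2) * sigma_mex (int n - int (j * (j + 1) div 2)))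
       = (\<Sum>j::nat. D1 ((of_nat n - of_nat (j * (j + 1) div 2)) / 2))"
proof -
  define T where "T j = j * (j + 1) div 2" for j :: nat
  have "(\<Sum>j::nat. (-1) ^ T j * sigma_mex (int n - int (T j))) =
      (\<Sum>j\<le>n. (-1) ^ T j * sigma_mex (int n - int (T j)))"
    by (rule suminf_finite) (use sigma_mex_eq_0[of n] in \<open>auto simp: T_def not_le\<close>)
  \<comment> \<open>The bound \<open>n\<close> serves for every shifted argument
    \<open>n - T j\<close>, so the double sum is over a square and the order of summation can be
    exchanged.\<close>
  also have "\<dots> = (\<Sum>j\<le>n. \<Sum>k\<le>n. (-1) ^ T j * part_count (int n - int (T j) - int (T k)))"
    using sigma_mex_eq_sum[of _ n, folded T_def] by (simp add: sum_distrib_left)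
  also have "\<dots> = (\<Sum>k\<le>n. \<Sum>j\<le>n. (-1) ^ T j * part_count (int n - int (T k) - int (T j)))"
    by (subst sum.swap) (simp add: algebra_simps)
  also have "\<dots> = (\<Sum>k\<le>n. D1 ((of_nat n - of_nat (T k)) / 2))"
  proof (rule sum.cong[OF refl])
    fix k
    show "(\<Sum>j\<le>n. (-1) ^ T j * part_count (int n - int (T k) - int (T j))) =
        D1 ((of_nat n - of_nat (T k)) / 2)"
    proof (cases "T k \<le> n")
      case True
      then show ?thesis
        using alternating_part_count_sum[of "n - T k" n, folded T_def] by (simp add: of_nat_diff)
    next
      \<comment> \<open>Beyond \<open>n\<close> both sides vanish: \<open>D1\<close> has a negative
        argument and so has every \<open>part_count\<close>.\<close>
      case False
      then have "(of_nat n - of_nat (T k)) / 2 < (0 :: rat)" by simp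
      then have "(of_nat n - of_nat (T k)) / 2 \<notin> (\<nat> :: rat set)"
        by (metis Nats_cases not_less of_nat_0_le_iff)
      then show ?thesis using False by (simp add: D1_def part_count_def)
    qed
  qed
  also have "\<dots> = (\<Sum>k::nat. D1 ((of_nat n - of_nat (T k)) / 2))"
    by (rule suminf_finite[symmetric]) (use D1_eq_0[of n] in \<open>auto simp: T_def not_le\<close>)
  finally show ?thesis unfolding T_def .
qed

end
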